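(* Consider one step of the semi-implicit scheme $$f_i^{n+1}=f_i^n+\Delta t\,\frac{\hat{\mathcal F}^{n+1}_{i+1/2}-\hat{\mathcal F}^{n+1}_{i-1/2}}{\Delta w},\qquad i=0,\dots,N,\qquad \hat{\mathcal F}^{n+1}_{-1/2}=\hat{\mathcal F}^{n+1}_{N+1/2}=0,$$ where for $i=0,\dots,N-1$ $$\hat{\mathcal F}^{n+1}_{i+1/2}=\tilde{\mathcal C}^n_{i+1/2}\left[(1-\delta^n_{i+1/2})f^{n+1}_{i+1}+\delta^n_{i+1/2}f^{n+1}_i\right]+D_{i+1/2}\frac{f^{n+1}_{i+1}-f^{n+1}_i}{\Delta w},$$ with $\tilde{\mathcal C}^n_{i+1/2},\delta^n_{i+1/2}$ (computed from time level $n$) as defined in the context. Let $M=\max_{0\le i\le N-1}|\tilde{\mathcal C}^n_{i+1/2}|$. If $\Delta t>0$ satisfies $$\Delta t<\frac{\Delta w}{2M}$$ (no restriction if $M=0$), then the scheme preserves nonnegativity: if $f_i^n\ge0$ for all $i=0,\dots,N$, then $f_i^{n+1}\ge 0$ for all $i=0,\dots,N$.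
   Context: The scheme discretizes $\partial_t f=\partial_w\left[(\mathcal B[f]+D')f+D\,\partial_w f\right]$ in one dimension. Grid: $w_0<\dots<w_N$ with uniform spacing $w_{i+1}-w_i=\Delta w>0$, $w_{i+1/2}=w_i+\Delta w/2$. The diffusion function $D\ge0$ is continuously differentiable and strictly positive at interior points of the computational domain, $D'=\partial_wD$, $D_{i+1/2}=D(w_{i+1/2})>0$. At time level $n$, $\mathcal B^n(w)=\mathcal B[f^n](w)$ is a given real-valued function of $w$ determined by the known values $f^n$. For $i=0,\dots,N-1$, $$\lambda^n_{i+1/2}=\int_{w_i}^{w_{i+1}}\frac{\mathcal B^n(w)+D'(w)}{D(w)}\,dw,\qquad \tilde{\mathcal C}^n_{i+1/2}=\frac{D_{i+1/2}}{\Delta w}\lambda^n_{i+1/2},\qquad \delta^n_{i+1/2}=\frac{1}{\lambda^n_{i+1/2}}+\frac{1}{1-\exp(\lambda^n_{i+1/2})},$$ where the integrals are assumed finite, and $\delta^n_{i+1/2}=1/2$ (the continuous extension) if $\lambda^n_{i+1/2}=0$. *)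

theory Defs
  imports "HOL-Analysis.Analysis"
begin

text \<open>Quantities living at \<open>w\<^bsub>i+1/2\<^esub>\<close> carry the index \<open>i\<close>. The argument \<open>b\<close> is the frozen drift
  \<open>w \<mapsto> \<B>[f\<^sup>n](w)\<close>, and \<open>D'\<close> is the derivative of \<open>D\<close>.\<close>

definition w_half :: "(nat \<Rightarrow> real) \<Rightarrow> real \<Rightarrow> nat \<Rightarrow> real" where
  "w_half w dw i = w i + dw / 2"

definition lambda_integrand ::
    "(real \<Rightarrow> real) \<Rightarrow> (real \<Rightarrow> real) \<Rightarrow> (real \<Rightarrow> real) \<Rightarrow> real \<Rightarrow> real" where
  "lambda_integrand D D' b x = (b x + D' x) / D x"

text \<open>The gauge integral covers both the Lebesgue and the improper Riemann reading. The latter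
  matters in the two boundary cells, since \<open>D\<close> may vanish at \<open>w\<^sub>0\<close> and at \<open>w\<^sub>N\<close>; the totalised
  value of the quotient at those two points does not affect the integral.\<close>

definition lambda_half ::
    "(nat \<Rightarrow> real) \<Rightarrow> (real \<Rightarrow> real) \<Rightarrow> (real \<Rightarrow> real) \<Rightarrow> (real \<Rightarrow> real) \<Rightarrow> nat \<Rightarrow> real" where
  "lambda_half w D D' b i = integral {w i..w (Suc i)} (lambda_integrand D D' b)"

definition C_half ::
    "(nat \<Rightarrow> real) \<Rightarrow> real \<Rightarrow> (real \<Rightarrow> real) \<Rightarrow> (real \<Rightarrow> real) \<Rightarrow> (real \<Rightarrow> real) \<Rightarrow> nat \<Rightarrow> real" where
  "C_half w dw D D' b i = D (w_half w dw i) / dw * lambda_half w D D' b i"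

definition delta_half ::
    "(nat \<Rightarrow> real) \<Rightarrow> (real \<Rightarrow> real) \<Rightarrow> (real \<Rightarrow> real) \<Rightarrow> (real \<Rightarrow> real) \<Rightarrow> nat \<Rightarrow> real" where
  "delta_half w D D' b i =
    (if lambda_half w D D' b i = 0 then 1 / 2
     else 1 / lambda_half w D D' b i + 1 / (1 - exp (lambda_half w D D' b i)))"

definition flux_half ::
    "(nat \<Rightarrow> real) \<Rightarrow> real \<Rightarrow> (real \<Rightarrow> real) \<Rightarrow> (real \<Rightarrow> real) \<Rightarrow> (real \<Rightarrow> real) \<Rightarrow>
     (nat \<Rightarrow> real) \<Rightarrow> nat \<Rightarrow> real" where
  "flux_half w dw D D' b g i =
    C_half w dw D D' b i *
      ((1 - delta_half w D D' b i) * g (Suc i) + delta_half w D D' b i * g i)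
    + D (w_half w dw i) * ((g (Suc i) - g i) / dw)"

text \<open>Here the index is shifted, so that the outer boundary fits into \<open>nat\<close>: edge \<open>k\<close> is
  \<open>w\<^bsub>k-1/2\<^esub>\<close> for \<open>k = 0, \<dots>, N + 1\<close>, with zero flux through edges \<open>0\<close> and \<open>N + 1\<close>.\<close>

definition edge_flux ::
    "nat \<Rightarrow> (nat \<Rightarrow> real) \<Rightarrow> real \<Rightarrow> (real \<Rightarrow> real) \<Rightarrow> (real \<Rightarrow> real) \<Rightarrow> (real \<Rightarrow> real) \<Rightarrow>
     (nat \<Rightarrow> real) \<Rightarrow> nat \<Rightarrow> real" where
  "edge_flux N w dw D D' b g k =
    (if k = 0 \<or> k = N + 1 then 0 else flux_half w dw D D' b g (k - 1))"

text \<open>\<open>g\<close> is obtained from \<open>f\<close> by one step: the coefficients are frozen through \<open>b\<close>, whereas the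
  flux is evaluated at the new values \<open>g\<close>.\<close>

definition semi_implicit_step ::
    "nat \<Rightarrow> (nat \<Rightarrow> real) \<Rightarrow> real \<Rightarrow> real \<Rightarrow> (real \<Rightarrow> real) \<Rightarrow> (real \<Rightarrow> real) \<Rightarrow> (real \<Rightarrow> real) \<Rightarrow>
     (nat \<Rightarrow> real) \<Rightarrow> (nat \<Rightarrow> real) \<Rightarrow> bool" where
  "semi_implicit_step N w dw dt D D' b f g \<longleftrightarrow>
    (\<forall>i\<le>N. g i = f i + dt * ((edge_flux N w dw D D' b g (i + 1) - edge_flux N w dw D D' b g i) / dw))"

end

theory Submission imports Defs begin

text \<open>Each flux has the form \<open>a g\<^bsub>i+1\<^esub> - c g\<^bsub>i\<^esub>\<close> with \<open>a, c > 0\<close>: for \<open>\<lambda> \<noteq> 0\<close> one finds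
  \<open>c = (D / \<Delta>w) \<lambda> / (exp \<lambda> - 1)\<close> and \<open>a = c exp \<lambda>\<close>, and \<open>a = c = D / \<Delta>w\<close> for \<open>\<lambda> = 0\<close>. Now sum
  the scheme over the set \<open>S\<close> of indices with \<open>g\<^bsub>i\<^esub> < 0\<close>. Fluxes between two indices of \<open>S\<close> cancel, and
  those between \<open>S\<close> and its complement point into \<open>S\<close>. Hence the sum of \<open>g\<close> over \<open>S\<close> is at
  least that of \<open>f\<close>, which is nonnegative, and \<open>S\<close> must be empty.\<close>

text \<open>Summation by parts. With \<open>s\<close> an indicator, only edges at which
  \<open>s\<close> jumps contribute.\<close>

lemma sum_by_parts_atMost:
  fixes s E :: "nat \<Rightarrow> 'a::comm_ring"
  shows "(\<Sum>i\<le>N. s i * (E (Suc i) - E i)) =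
    (\<Sum>k<N. (s k - s (Suc k)) * E (Suc k)) + s N * E (Suc N) - s 0 * E 0"
  by (induction N) (simp_all add: algebra_simps)

lemma conservative_upwind_step_nonneg:
  fixes f g E :: "nat \<Rightarrow> real"
  assumes r: "r \<ge> 0"
    and step: "\<And>i. i \<le> N \<Longrightarrow> g i = f i + r * (E (Suc i) - E i)"
    and bdry: "E 0 = 0" "E (Suc N) = 0"
    and flux: "\<And>k. k < N \<Longrightarrow> \<exists>a\<ge>0. \<exists>c\<ge>0. E (Suc k) = a * g (Suc k) - c * g k"
    and f_nonneg: "\<And>i. i \<le> N \<Longrightarrow> f i \<ge> 0"
    and "i \<le> N"
  shows "g i \<ge> 0"
proof (rule ccontr)
  assume neg: "\<not> g i \<ge> 0"
  \<comment> \<open>\<open>s\<close> is the indicator of S, so \<open>s j * g j\<close> is the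
    negative part \<open>min (g j) 0\<close>.\<close>
  define s :: "nat \<Rightarrow> real" where "s j = (if g j < 0 then 1 else 0)" for j
  have edge: "(s k - s (Suc k)) * E (Suc k) \<ge> 0" if k: "k < N" for k
  proof -
    obtain a c where ac: "a \<ge> 0" "c \<ge> 0" "E (Suc k) = a * g (Suc k) - c * g k"
      using flux[OF k] by blast
    \<comment> \<open>Either the edge does not separate S from its complement and the weight
      vanishes, or exactly one endpoint lies in S, which fixes the sign of both terms of the
      flux.\<close>
    consider "s k = s (Suc k)" | "g k < 0" "g (Suc k) \<ge> 0" | "g k \<ge> 0" "g (Suc k) < 0"
      unfolding s_def by fastforce
    then show ?thesis
    proof cases
      case 2
      then have "a * g (Suc k) \<ge> 0" "c * g k \<le> 0"
        using ac by (simp_all add: mult_nonneg_nonpos)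
      then have "E (Suc k) \<ge> 0" using ac(3) by linarith
      with 2 show ?thesis by (simp add: s_def)
    next
      case 3
      then have "a * g (Suc k) \<le> 0" "c * g k \<ge> 0"
        using ac by (simp_all add: mult_nonneg_nonpos)
      then have "E (Suc k) \<le> 0" using ac(3) by linarith
      with 3 show ?thesis by (simp add: s_def)
    qed simp
  qed
  have "(\<Sum>j\<le>N. s j * g j) = (\<Sum>j\<le>N. s j * f j + r * (s j * (E (Suc j) - E j)))"
    by (rule sum.cong) (simp_all add: step algebra_simps)
  also have "\<dots> = (\<Sum>j\<le>N. s j * f j) + r * (\<Sum>k<N. (s k - s (Suc k)) * E (Suc k))"
    using sum_by_parts_atMost[of s E N] bdry by (simp add: sum.distrib flip: sum_distrib_left)
  also have "\<dots> \<ge> 0"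
  proof (rule add_nonneg_nonneg)
    show "(\<Sum>j\<le>N. s j * f j) \<ge> 0"
      using f_nonneg by (intro sum_nonneg) (simp add: s_def)
    show "r * (\<Sum>k<N. (s k - s (Suc k)) * E (Suc k)) \<ge> 0"
      by (intro mult_nonneg_nonneg sum_nonneg r edge) simp
  qed
  finally have "(\<Sum>j\<le>N. s j * g j) \<ge> 0" .
  \<comment> \<open>No term is positive, and the one at \<open>i\<close> is negative.\<close>
  moreover have "(\<Sum>j\<le>N. s j * g j) < (\<Sum>j\<le>N. 0)"
  proof (rule sum_strict_mono_ex1)
    show "\<exists>j\<in>{..N}. s j * g j < 0"
      using neg \<open>i \<le> N\<close> by (intro bexI[of _ i]) (simp_all add: s_def)
  qed (simp_all add: s_def)
  ultimately show False by simp
qed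

text \<open>Numerator and denominator have the same sign.\<close>

lemma divide_exp_minus_1_pos:
  fixes x :: real
  assumes "x \<noteq> 0"
  shows "x / (exp x - 1) > 0"
  using assms by (cases "x > 0") (simp_all add: zero_less_divide_iff)

lemma flux_half_upwind:
  assumes "dw > 0" and "D (w_half w dw i) \<ge> 0"
  shows "\<exists>a\<ge>0. \<exists>c\<ge>0. flux_half w dw D D' b g i = a * g (Suc i) - c * g i"
proof -
  define l where "l = lambda_half w D D' b i"
  define d where "d = D (w_half w dw i) / dw"
  \<comment> \<open>The Bernoulli function x / (exp x - 1) at \<open>l\<close>, with its continuous
    extension 1 at 0.\<close>
  define p where "p = (if l = 0 then 1 else l / (exp l - 1))"
  have d: "d \<ge> 0" and p: "p > 0"
    using assms divide_exp_minus_1_pos by (simp_all add: d_def p_def)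
  \<comment> \<open>This shows \<open>l + p\<close> to be positive even when \<open>l\<close> is
    negative.\<close>
  have lp: "l + p = p * exp l"
    by (simp add: p_def field_simps)
  \<comment> \<open>Delta enters the flux only through this product; for \<open>l = 0\<close> both
    sides are 0.\<close>
  have ldelta: "l * delta_half w D D' b i = 1 - p"
    unfolding delta_half_def p_def l_def[symmetric] by (simp add: field_simps)
  have "flux_half w dw D D' b g i =
      d * (l + 1 - l * delta_half w D D' b i) * g (Suc i)
      - d * (1 - l * delta_half w D D' b i) * g i"
    unfolding flux_half_def C_half_def l_def d_def by (simp add: algebra_simps add_divide_distrib diff_divide_distrib)
  also have "\<dots> = d * (l + p) * g (Suc i) - d * p * g i"
    unfolding ldelta by (simp add: algebra_simps)
  finally have "flux_half w dw D D' b g i = d * (l + p) * g (Suc i) - d * p * g i" .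
  moreover have "d * (l + p) \<ge> 0" "d * p \<ge> 0"
    using d p lp by simp_all
  ultimately show ?thesis by blast
qed

lemma uniform_grid_eq:
  fixes w :: "nat \<Rightarrow> real"
  assumes "\<And>i. i < N \<Longrightarrow> w (Suc i) - w i = dw" and "i \<le> N"
  shows "w i = w 0 + real i * dw"
  using assms(2)
proof (induction i)
  case (Suc i)
  then show ?case using assms(1)[of i] by (simp add: algebra_simps)
qed simp

text \<open>Midpoints stay strictly inside the domain even in the two boundary cells, so the
  positivity of \<open>D\<close> in the interior applies to them.\<close>

lemma w_half_in_interior:
  assumes "dw > 0" and "\<And>i. i < N \<Longrightarrow> w (Suc i) - w i = dw" and "i < N"
  shows "w_half w dw i \<in> {w 0<..<w N}"
proof -
  \<comment> \<open>The right end of cell \<open>i\<close> is at most \<open>w N\<close>, and the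
    midpoint lies half a cell before it.\<close>
  have "(real i + 1) * dw \<le> real N * dw"
    using assms by (intro mult_right_mono) auto
  moreover have "real i * dw \<ge> 0" using assms by simp
  moreover have "w i = w 0 + real i * dw" "w N = w 0 + real N * dw"
    by (rule uniform_grid_eq[of N]; use assms in simp)+
  ultimately show ?thesis
    using \<open>dw > 0\<close> unfolding w_half_def greaterThanLessThan_iff distrib_right
    by (intro conjI) linarith+
qed

theorem proposition2:
  fixes N n :: nat
    and w :: "nat \<Rightarrow> real"
    and dw dt M :: real
    and D D' :: "real \<Rightarrow> real"
    and B :: "(nat \<Rightarrow> real) \<Rightarrow> real \<Rightarrow> real"
    and f :: "nat \<Rightarrow> nat \<Rightarrow> real"
  assumes N_pos: "N \<ge> 1"
    and dw_pos: "dw > 0"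
    and grid: "\<And>i. i < N \<Longrightarrow> w (Suc i) - w i = dw"
    and D_deriv: "\<And>x. x \<in> {w 0..w N} \<Longrightarrow> (D has_real_derivative D' x) (at x within {w 0..w N})"
    and D'_cont: "continuous_on {w 0..w N} D'"
    and D_nonneg: "\<And>x. x \<in> {w 0..w N} \<Longrightarrow> D x \<ge> 0"
    and D_pos: "\<And>x. x \<in> {w 0<..<w N} \<Longrightarrow> D x > 0"
    and integrals_finite:
      "\<And>i. i < N \<Longrightarrow> lambda_integrand D D' (B (f n)) integrable_on {w i..w (Suc i)}"
    and scheme: "semi_implicit_step N w dw dt D D' (B (f n)) (f n) (f (Suc n))"
    and M_def: "M = Max ((\<lambda>i. \<bar>C_half w dw D D' (B (f n)) i\<bar>) ` {0..N - 1})"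
    and dt_pos: "dt > 0"
    and dt_bound: "M \<noteq> 0 \<Longrightarrow> dt < dw / (2 * M)"
    and f_nonneg: "\<And>i. i \<le> N \<Longrightarrow> f n i \<ge> 0"
  shows "\<forall>i\<le>N. f (Suc n) i \<ge> 0"
proof (intro allI impI)
  fix i assume "i \<le> N"
  define E where "E = edge_flux N w dw D D' (B (f n)) (f (Suc n))"
  show "f (Suc n) i \<ge> 0"
  proof (rule conservative_upwind_step_nonneg[where r = "dt / dw" and E = E])
    fix j assume "j \<le> N"
    then show "f (Suc n) j = f n j + dt / dw * (E (Suc j) - E j)"
      using scheme by (simp add: semi_implicit_step_def E_def)
  next
    fix k assume "k < N"
    then have "D (w_half w dw k) \<ge> 0"
      using D_pos[OF w_half_in_interior[of dw N w k]] dw_pos grid by (simp add: less_imp_le)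
    \<comment> \<open>Edge \<open>Suc k\<close> is neither 0 nor \<open>N + 1\<close>, so
      \<open>E (Suc k)\<close> is \<open>flux_half\<close> at index \<open>k\<close>.\<close>
    with \<open>k < N\<close> show "\<exists>a\<ge>0. \<exists>c\<ge>0. E (Suc k) = a * f (Suc n) (Suc k) - c * f (Suc n) k"
      using flux_half_upwind[OF dw_pos] by (simp add: E_def edge_flux_def)
  qed (use dt_pos dw_pos f_nonneg \<open>i \<le> N\<close> in \<open>simp_all add: E_def edge_flux_def\<close>)
qed

end
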